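(* Let $u\in L^1(Q)$ and let $\mathcal B_n,\mathcal B\in\Pi^d$ be such that $\mathcal B_n\to\mathcal B$ in $\ell^\infty$. Then $$\liminf_{n\to\infty}PV_{\mathcal B_n}(u)\ge PV_{\mathcal B}(u).$$
   Context: Let $d,N\ge1$ be integers and $Q=(0,1)^N$. For $1\le h\le d$, $H^hu\in\mathcal D'(Q;\mathbb R^{N^h})$ is the array of all $h$-th order distributional partial derivatives of $u$. Put $K=\sum_{h=1}^dN^h$, so $\mathbb R^K=\bigoplus_{h=1}^d\mathbb R^{N^h}$. $\Pi^d$ is the set of operators $\mathcal B$ given by real matrices $B^h\in\mathbb R^{N^h\times N^h}$, $1\le h\le d$, through $\mathcal Bu=(B^1H^1u,\dots,B^dH^du)\in\mathcal D'(Q;\mathbb R^K)$. $\mathcal B_n\to\mathcal B$ in $\ell^\infty$ means $|\mathcal B_n-\mathcal B|:=\sum_{h=1}^d|B_n^h-B^h|_{\ell^\infty}\to0$, where $|\cdot|_{\ell^\infty}$ is the $\ell^\infty$ matrix norm. $\mathcal B^*$ is the formal adjoint: $\int_Qu\,\mathcal B^*\varphi\,dx=\int_Q\varphi\cdot\mathcal Bu\,dx$ for $\varphi\in C_c^\infty(Q;\mathbb R^K)$ and smooth $u$. For $u\in L^1(Q)$, $PV_{\mathcal B}(u)=\sup\{\int_Qu\,\mathcal B^*\varphi\,dx:\varphi\in C_c^\infty(Q;\mathbb R^K),\ |\varphi|\le1\}\in[0,+\infty]$ (Euclidean norm on $\mathbb R^K$). *)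

theory Defs
  imports "HOL-Analysis.Analysis"
begin

section \<open>Smooth functions and test functions\<close>

text \<open>
  \<open>N\<close> is the cardinality of the index type \<open>'n\<close>, and \<open>Q = (0,1)\<^sup>N\<close>.
\<close>

definition Q :: "(real ^ 'n) set"
  where "Q = {x. \<forall>i. 0 < x $ i \<and> x $ i < 1}"

definition partial :: "'n \<Rightarrow> (real ^ 'n \<Rightarrow> real) \<Rightarrow> real ^ 'n \<Rightarrow> real"
  where "partial i f x = frechet_derivative f (at x) (axis i 1)"

primrec partials :: "'n list \<Rightarrow> (real ^ 'n \<Rightarrow> real) \<Rightarrow> real ^ 'n \<Rightarrow> real"
  where
    "partials [] f = f"
  | "partials (i # is) f = partial i (partials is f)"

text \<open>
  \<open>C\<^sup>\<infinity>\<close> on an open set \<open>S\<close>. Differentiability of all iterated partial derivatives entails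
  their continuity; conversely, existence and continuity of all of them entails
  differentiability.
\<close>

definition smooth_on :: "(real ^ 'n) set \<Rightarrow> (real ^ 'n \<Rightarrow> real) \<Rightarrow> bool"
  where "smooth_on S f \<longleftrightarrow> (\<forall>is. \<forall>x\<in>S. partials is f differentiable (at x))"

text \<open>
  \<open>C\<^sub>c\<^sup>\<infinity>(Q)\<close>, its elements being extended by zero to the whole space.
\<close>

definition test_function :: "(real ^ 'n \<Rightarrow> real) \<Rightarrow> bool"
  where "test_function f \<longleftrightarrow>
    smooth_on UNIV f \<and> compact (closure {x. f x \<noteq> 0}) \<and> closure {x. f x \<noteq> 0} \<subseteq> Q"


section \<open>The operators\<close>

text \<open>
  A coordinate of \<open>\<real>\<^bsup>N^h\<^esup>\<close> is a list of length \<open>h\<close> of directions, so that the entries of the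
  array \<open>H\<^sup>hu\<close> are \<open>partials \<beta> u\<close> with \<open>length \<beta> = h\<close>; there is no identification of permuted
  lists. The coordinates of \<open>\<real>\<^sup>K\<close> are the lists of length between \<open>1\<close> and \<open>d\<close>.
\<close>

definition coords :: "nat \<Rightarrow> 'n list set"
  where "coords d = {\<alpha>. 1 \<le> length \<alpha> \<and> length \<alpha> \<le> d}"

text \<open>
  \<open>B h \<alpha> \<beta>\<close> is the entry of the matrix \<open>B\<^sup>h\<close> in row \<open>\<alpha>\<close> and column \<open>\<beta>\<close>. Entries with indices
  out of range are normalised to zero, so that the elements of \<open>\<Pi>\<^sup>d\<close> are exactly the families of
  \<open>d\<close> real matrices of sizes \<open>N\<^sup>h \<times> N\<^sup>h\<close>.
\<close>

type_synonym 'n op = "nat \<Rightarrow> 'n list \<Rightarrow> 'n list \<Rightarrow> real"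

definition Pi_ops :: "nat \<Rightarrow> 'n op set"
  where "Pi_ops d =
    {B. \<forall>h \<alpha> \<beta>. \<not> (1 \<le> h \<and> h \<le> d \<and> length \<alpha> = h \<and> length \<beta> = h) \<longrightarrow> B h \<alpha> \<beta> = 0}"

text \<open>The \<open>\<ell>\<^sup>\<infinity>\<close> norm of a matrix is the largest absolute value of an entry.\<close>

definition linf_norm :: "nat \<Rightarrow> ('n::finite list \<Rightarrow> 'n list \<Rightarrow> real) \<Rightarrow> real"
  where "linf_norm h A = Max {\<bar>A \<alpha> \<beta>\<bar> |\<alpha> \<beta>. length \<alpha> = h \<and> length \<beta> = h}"

definition op_dist :: "nat \<Rightarrow> 'n::finite op \<Rightarrow> 'n op \<Rightarrow> real"
  where "op_dist d A B = (\<Sum>h=1..d. linf_norm h (\<lambda>\<alpha> \<beta>. A h \<alpha> \<beta> - B h \<alpha> \<beta>))"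

text \<open>The \<open>\<alpha>\<close>-th coordinate of \<open>\<B>u\<close> at \<open>x\<close>, for a smooth function \<open>u\<close>.\<close>

definition apply_op :: "'n::finite op \<Rightarrow> (real ^ 'n \<Rightarrow> real) \<Rightarrow> real ^ 'n \<Rightarrow> 'n list \<Rightarrow> real"
  where "apply_op B u x \<alpha> =
    (\<Sum>\<beta> | length \<beta> = length \<alpha>. B (length \<alpha>) \<alpha> \<beta> * partials \<beta> u x)"

text \<open>\<open>C\<^sub>c\<^sup>\<infinity>(Q; \<real>\<^sup>K)\<close>; only the coordinates in \<open>coords d\<close> of a field are ever used.\<close>

definition test_field :: "nat \<Rightarrow> (real ^ 'n \<Rightarrow> 'n list \<Rightarrow> real) \<Rightarrow> bool"
  where "test_field d \<phi> \<longleftrightarrow> (\<forall>\<alpha>\<in>coords d. test_function (\<lambda>x. \<phi> x \<alpha>))"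

text \<open>
  The formal adjoint \<open>\<B>\<^sup>*\<phi>\<close> is determined by duality. Existence, uniqueness and the explicit
  formula are in \<open>formal_adjoint_eq\<close> and \<open>formal_adjoint\<close> below.
\<close>

definition is_formal_adjoint ::
    "nat \<Rightarrow> 'n::finite op \<Rightarrow> (real ^ 'n \<Rightarrow> 'n list \<Rightarrow> real) \<Rightarrow> (real ^ 'n \<Rightarrow> real) \<Rightarrow> bool"
  where "is_formal_adjoint d B \<phi> \<psi> \<longleftrightarrow> test_function \<psi> \<and>
    (\<forall>u. smooth_on Q u \<longrightarrow>
      (LINT x:Q|lebesgue. u x * \<psi> x) =
      (LINT x:Q|lebesgue. \<Sum>\<alpha>\<in>coords d. \<phi> x \<alpha> * apply_op B u x \<alpha>))"

definition formal_adjoint ::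
    "nat \<Rightarrow> 'n::finite op \<Rightarrow> (real ^ 'n \<Rightarrow> 'n list \<Rightarrow> real) \<Rightarrow> real ^ 'n \<Rightarrow> real"
  where "formal_adjoint d B \<phi> = (THE \<psi>. is_formal_adjoint d B \<phi> \<psi>)"

definition PV :: "nat \<Rightarrow> 'n::finite op \<Rightarrow> (real ^ 'n \<Rightarrow> real) \<Rightarrow> ereal"
  where "PV d B u =
    (SUP \<phi> \<in> {\<phi>. test_field d \<phi> \<and> (\<forall>x. L2_set (\<phi> x) (coords d) \<le> 1)}.
      ereal (LINT x:Q|lebesgue. u x * formal_adjoint d B \<phi> x))"


section \<open>Well-definedness of the formal adjoint\<close>

lemma open_Q: "open (Q :: (real ^ 'n) set)"
proof -
  have "Q = (box 0 1 :: (real ^ 'n) set)"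
    by (auto simp: Q_def mem_box_cart)
  then show ?thesis by (metis open_box)
qed

lemma finite_lists_length [simp]: "finite {\<beta> :: 'n::finite list. length \<beta> = h}"
  using finite_lists_length_eq [of "UNIV :: 'n set" h] by simp

lemma finite_coords [simp]: "finite (coords d :: 'n::finite list set)"
proof -
  have "coords d = (\<Union>h\<in>{1..d}. {\<alpha> :: 'n list. length \<alpha> = h})"
    by (auto simp: coords_def)
  then show ?thesis by simp
qed

lemma partials_append: "partials (is @ js) f = partials is (partials js f)"
  by (induction "is") auto

lemma smooth_on_partials: "smooth_on S f \<Longrightarrow> smooth_on S (partials is f)"
  unfolding smooth_on_def by (metis partials_append)

lemma smooth_on_partial: "smooth_on S f \<Longrightarrow> smooth_on S (partial i f)"
  using smooth_on_partials [of S f "[i]"] by simp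

lemma smooth_on_differentiable: "smooth_on S f \<Longrightarrow> x \<in> S \<Longrightarrow> f differentiable (at x)"
  unfolding smooth_on_def by (metis partials.simps(1))

lemma smooth_on_continuous: "smooth_on S f \<Longrightarrow> continuous_on S f"
  by (meson continuous_at_imp_continuous_on differentiable_imp_continuous_within
      smooth_on_differentiable)

lemma smooth_on_subset: "smooth_on S f \<Longrightarrow> T \<subseteq> S \<Longrightarrow> smooth_on T f"
  unfolding smooth_on_def by blast

lemma partial_eq:
  assumes "(f has_derivative f') (at x)"
  shows "partial i f x = f' (axis i 1)"
  using frechet_derivative_at [OF assms] by (simp add: partial_def)

lemma partials_zero_fun: "partials is (\<lambda>x. 0) = (\<lambda>x. 0)"
  by (induction "is") (auto simp: partial_def)

lemma partials_add:
  assumes "smooth_on UNIV f" "smooth_on UNIV g"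
  shows "partials is (\<lambda>x. f x + g x) = (\<lambda>x. partials is f x + partials is g x)"
proof (induction "is")
  case (Cons i "is")
  have "partials is f differentiable (at x)" "partials is g differentiable (at x)" for x
    using assms by (auto simp: smooth_on_def)
  then have "partial i (\<lambda>x. partials is f x + partials is g x) x
      = partial i (partials is f) x + partial i (partials is g) x" for x
    by (subst partial_eq [OF has_derivative_add])
      (auto simp: partial_def frechet_derivative_works [symmetric])
  then show ?case using Cons by auto
qed simp

lemma partials_cmult:
  assumes "smooth_on UNIV f"
  shows "partials is (\<lambda>x. c * f x) = (\<lambda>x. c * partials is f x)"
proof (induction "is")
  case (Cons i "is")
  have "partials is f differentiable (at x)" for x
    using assms by (auto simp: smooth_on_def)
  then have "partial i (\<lambda>x. c * partials is f x) x = c * partial i (partials is f) x" for x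
    by (subst partial_eq [OF has_derivative_mult_right])
      (auto simp: partial_def frechet_derivative_works [symmetric])
  then show ?case using Cons by auto
qed simp

lemma smooth_on_add: "smooth_on UNIV f \<Longrightarrow> smooth_on UNIV g \<Longrightarrow> smooth_on UNIV (\<lambda>x. f x + g x)"
  by (auto simp: smooth_on_def partials_add intro!: differentiable_add)

lemma smooth_on_cmult: "smooth_on UNIV f \<Longrightarrow> smooth_on UNIV (\<lambda>x. c * f x)"
  by (auto simp: smooth_on_def partials_cmult intro!: differentiable_mult)

lemma smooth_on_zero: "smooth_on S (\<lambda>x. 0)"
  by (auto simp: smooth_on_def partials_zero_fun)

lemma test_function_zero: "test_function (\<lambda>x. 0)"
  by (simp add: test_function_def smooth_on_zero)

lemma test_functionI:
  assumes "smooth_on UNIV f" "compact K" "K \<subseteq> Q" "\<And>x. x \<notin> K \<Longrightarrow> f x = 0"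
  shows "test_function f"
proof -
  have "closure {x. f x \<noteq> 0} \<subseteq> K"
    using assms by (intro closure_minimal compact_imp_closed) auto
  moreover from this have "compact (closure {x. f x \<noteq> 0})"
    using assms(2) by (metis closed_closure compact_Int_closed inf.absorb_iff2)
  ultimately show ?thesis
    using assms by (auto simp: test_function_def)
qed

lemma test_function_support:
  assumes "test_function f"
  obtains K where "compact K" "K \<subseteq> Q" "\<And>x. x \<notin> K \<Longrightarrow> f x = 0"
proof
  show "compact (closure {x. f x \<noteq> 0})" "closure {x. f x \<noteq> 0} \<subseteq> Q"
    using assms unfolding test_function_def by blast+
  show "f x = 0" if "x \<notin> closure {x. f x \<noteq> 0}" for x
    using that closure_subset [of "{x. f x \<noteq> 0}"] by blast
qed

lemma test_function_smooth: "test_function f \<Longrightarrow> smooth_on UNIV f"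
  by (simp add: test_function_def)

lemma test_function_add:
  assumes "test_function f" "test_function g"
  shows "test_function (\<lambda>x. f x + g x)"
proof -
  obtain K L where "compact K" "K \<subseteq> Q" "\<And>x. x \<notin> K \<Longrightarrow> f x = 0"
    "compact L" "L \<subseteq> Q" "\<And>x. x \<notin> L \<Longrightarrow> g x = 0"
    using assms by (meson test_function_support)
  then show ?thesis
    using assms by (intro test_functionI [of _ "K \<union> L"])
      (auto intro: smooth_on_add test_function_smooth)
qed

lemma test_function_cmult: "test_function f \<Longrightarrow> test_function (\<lambda>x. c * f x)"
  using test_functionI [OF smooth_on_cmult [OF test_function_smooth, of f c]]
    test_function_support [of f] by (metis mult_zero_right)

lemma test_function_sum:
  "(\<And>a. a \<in> A \<Longrightarrow> test_function (f a)) \<Longrightarrow> test_function (\<lambda>x. \<Sum>a\<in>A. f a x)"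
  by (induction A rule: infinite_finite_induct) (auto simp: test_function_zero test_function_add)

lemma partial_zero_outside:
  assumes "closed K" "\<And>x. x \<notin> K \<Longrightarrow> f x = 0" "x \<notin> K"
  shows "partial i f x = 0"
proof -
  have "(f has_derivative (\<lambda>_. 0)) (at x)"
  proof (rule has_derivative_transform_within_open [of "\<lambda>_. 0"])
    show "open (- K)" "x \<in> - K" using assms by auto
    show "0 = f y" if "y \<in> - K" for y using assms(2) that by simp
  qed simp
  then show ?thesis by (simp add: partial_eq)
qed

lemma test_function_partial:
  assumes "test_function f"
  shows "test_function (partial i f)"
proof -
  obtain K where K: "compact K" "K \<subseteq> Q" "\<And>x. x \<notin> K \<Longrightarrow> f x = 0"
    using test_function_support [OF assms] by metis
  then show ?thesis
    using assms partial_zero_outside [OF compact_imp_closed [OF K(1)] K(3)]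
    by (intro test_functionI [of _ K])
      (auto simp: smooth_on_partial test_function_smooth)
qed

lemma test_function_partials: "test_function f \<Longrightarrow> test_function (partials is f)"
  by (induction "is") (auto intro: test_function_partial)

lemma continuous_on_mult_test_function:
  assumes "continuous_on Q f" "test_function g"
  shows "continuous_on UNIV (\<lambda>x. f x * g x)"
proof -
  let ?C = "- closure {x. g x \<noteq> 0}"
  have "continuous_on Q (\<lambda>x. f x * g x)"
    using assms
    by (intro continuous_intros)
      (auto intro: continuous_on_subset [OF smooth_on_continuous] test_function_smooth)
  moreover have "f x * g x = 0" if "x \<in> ?C" for x
    using that closure_subset [of "{x. g x \<noteq> 0}"] mult_eq_0_iff by blast
  then have "continuous_on ?C (\<lambda>x. f x * g x)"
    by (subst continuous_on_cong [OF refl, where g = "\<lambda>_. 0"]) (assumption, simp)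
  ultimately have "continuous_on (Q \<union> ?C) (\<lambda>x. f x * g x)"
    by (intro continuous_on_open_Un) (auto simp: open_Q)
  moreover have "Q \<union> ?C = UNIV"
    using assms by (auto simp: test_function_def)
  ultimately show ?thesis by simp
qed

lemma integrable_compact_support:
  fixes f :: "real ^ 'n \<Rightarrow> real"
  assumes "continuous_on UNIV f" "compact K" "\<And>x. x \<notin> K \<Longrightarrow> f x = 0"
  shows "integrable lborel f"
proof -
  have "integrable lborel (\<lambda>x. indicator K x *\<^sub>R f x)"
    using assms by (intro borel_integrable_compact) (auto intro: continuous_on_subset)
  moreover have "(\<lambda>x. indicator K x *\<^sub>R f x) = f"
    using assms(3) by (fastforce simp: indicator_def)
  ultimately show ?thesis by simp
qed

lemma integral_partial_zero:
  fixes F :: "real ^ 'n \<Rightarrow> real"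
  assumes diff: "\<And>x. F differentiable (at x)"
    and cont: "continuous_on UNIV (partial i F)"
    and K: "compact K" "\<And>x. x \<notin> K \<Longrightarrow> F x = 0"
  shows "(LINT x|lborel. partial i F x) = 0"
proof -
  let ?e = "axis i 1 :: real ^ 'n"
  have contF: "continuous_on UNIV F"
    using diff by (simp add: continuous_at_imp_continuous_on differentiable_imp_continuous_within)
  have zero: "partial i F x = 0" if "x \<notin> K" for x
    using partial_zero_outside K that compact_imp_closed by metis
  have "compact (partial i F ` K)"
    using cont K(1) by (meson compact_continuous_image continuous_on_subset subset_UNIV)
  then obtain M0 where M0: "\<And>x. x \<in> K \<Longrightarrow> \<bar>partial i F x\<bar> \<le> M0"
    using compact_imp_bounded [THEN bounded_iff [THEN iffD1]] by (metis image_eqI real_norm_def)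
  define M where "M = max M0 0"
  have M: "\<bar>partial i F x\<bar> \<le> M" for x
    using M0 zero by (cases "x \<in> K") (auto simp: M_def max.coboundedI1)
  obtain R where R: "\<And>x. x \<in> K \<Longrightarrow> norm x \<le> R"
    using K(1) compact_imp_bounded bounded_iff by metis
  define h where "h n = inverse (real (Suc n))" for n
  have h: "0 < h n" "h n \<le> 1" for n
    by (auto simp: h_def divide_simps)
  have line: "((\<lambda>t. F (x + t *\<^sub>R ?e)) has_real_derivative partial i F (x + t *\<^sub>R ?e)) (at t)" for x t
  proof -
    have D: "(F has_derivative frechet_derivative F (at (x + t *\<^sub>R ?e))) (at (x + t *\<^sub>R ?e))"
      using diff frechet_derivative_works by blast
    have "((\<lambda>t. F (x + t *\<^sub>R ?e)) has_derivative
        (\<lambda>s. frechet_derivative F (at (x + t *\<^sub>R ?e)) (s *\<^sub>R ?e))) (at t)"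
      by (rule has_derivative_compose [of "\<lambda>t. x + t *\<^sub>R ?e" _ _ _ F, OF _ D]) (auto intro!: derivative_eq_intros)
    moreover have "frechet_derivative F (at (x + t *\<^sub>R ?e)) (s *\<^sub>R ?e)
        = partial i F (x + t *\<^sub>R ?e) * s" for s
      using linear_frechet_derivative [OF diff, of "x + t *\<^sub>R ?e"]
      by (simp add: partial_def linear_scale)
    ultimately show ?thesis
      by (simp add: has_field_derivative_def)
  qed
  define s where "s n x = (F (h n *\<^sub>R ?e + x) - F x) / h n" for n x
  have "(\<lambda>n. LINT x|lborel. s n x) \<longlonglongrightarrow> (LINT x|lborel. partial i F x)"
  proof (rule integral_dominated_convergence [where w = "\<lambda>x. M * indicator (cball 0 (R + 1)) x"])
    show "partial i F \<in> borel_measurable lborel"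
      using cont borel_measurable_continuous_onI by simp
    show "s n \<in> borel_measurable lborel" for n
    proof -
      have "continuous_on UNIV (s n)"
        unfolding s_def using h(1) [of n]
        by (auto intro!: continuous_intros continuous_on_compose2 [OF contF])
      then show ?thesis using borel_measurable_continuous_onI by simp
    qed
    have "integrable lborel (\<lambda>x. indicator (cball 0 (R + 1)) x *\<^sub>R M :: real)"
      by (intro borel_integrable_compact) auto
    then show "integrable lborel (\<lambda>x. M * indicator (cball (0 :: real ^ 'n) (R + 1)) x)"
      by (simp add: mult.commute)
    show "AE x in lborel. (\<lambda>n. s n x) \<longlonglongrightarrow> partial i F x"
    proof (rule AE_I2)
      fix x
      have "((\<lambda>t. (F (x + t *\<^sub>R ?e) - F x) / t) \<longlongrightarrow> partial i F x) (at 0)"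
        using line [of x 0] by (simp add: has_field_derivative_iff)
      moreover have "filterlim h (at 0) sequentially"
        unfolding filterlim_at
        using h(1) LIMSEQ_inverse_real_of_nat by (auto simp: h_def [abs_def])
      ultimately have "(\<lambda>n. (F (x + h n *\<^sub>R ?e) - F x) / h n) \<longlonglongrightarrow> partial i F x"
        by (rule filterlim_compose)
      then show "(\<lambda>n. s n x) \<longlonglongrightarrow> partial i F x"
        by (simp add: s_def add.commute)
    qed
    show "AE x in lborel. norm (s n x) \<le> M * indicator (cball 0 (R + 1)) x" for n
    proof (rule AE_I2)
      fix x
      show "norm (s n x) \<le> M * indicator (cball 0 (R + 1)) x"
      proof (cases "norm x \<le> R + 1")
        case True
        obtain z where "F (x + h n *\<^sub>R ?e) - F (x + 0 *\<^sub>R ?e)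
            = (h n - 0) * partial i F (x + z *\<^sub>R ?e)"
          using MVT2 [OF h(1) line] by blast
        then have "s n x = partial i F (x + z *\<^sub>R ?e)"
          using h(1) [of n] by (simp add: s_def add.commute)
        then show ?thesis using M True by simp
      next
        case False
        have "norm (h n *\<^sub>R ?e) \<le> 1"
          using h [of n] by simp
        then have "norm x \<le> norm (h n *\<^sub>R ?e + x) + 1"
          using norm_triangle_ineq4 [of "h n *\<^sub>R ?e + x" "h n *\<^sub>R ?e"] by simp
        then have "x \<notin> K" "h n *\<^sub>R ?e + x \<notin> K"
          using False R [of x] R [of "h n *\<^sub>R ?e + x"] by auto
        then show ?thesis using K(2) False by (simp add: s_def)
      qed
    qed
  qed
  moreover have "(LINT x|lborel. s n x) = 0" for n
  proof -
    have int: "integrable lborel F"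
      using integrable_compact_support contF K by blast
    have int': "integrable lborel (\<lambda>x. F (h n *\<^sub>R ?e + x))"
    proof -
      have "integrable (distr lborel borel ((+) (h n *\<^sub>R ?e))) F"
        using int by (simp add: lborel_distr_plus)
      then show ?thesis
        by (subst (asm) integrable_distr_eq) (use int in auto)
    qed
    have "(LINT x|lborel. F (h n *\<^sub>R ?e + x)) = (LINT x|distr lborel borel ((+) (h n *\<^sub>R ?e)). F x)"
      by (subst integral_distr) (use int in auto)
    also have "\<dots> = (LINT x|lborel. F x)"
      by (simp add: lborel_distr_plus)
    finally show ?thesis
      using int int' by (simp add: s_def)
  qed
  ultimately show ?thesis
    by (simp add: LIMSEQ_const_iff)
qed

lemma set_integral_Q:
  fixes f :: "real ^ 'n \<Rightarrow> real"
  assumes "continuous_on UNIV f" "\<And>x. x \<notin> Q \<Longrightarrow> f x = 0"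
  shows "(LINT x:Q|lebesgue. f x) = (LINT x|lborel. f x)"
proof -
  have "(\<lambda>x. indicator Q x *\<^sub>R f x) = f"
    using assms(2) by (fastforce simp: indicator_def)
  then have "(LINT x:Q|lebesgue. f x) = (LINT x|lebesgue. f x)"
    by (simp add: set_lebesgue_integral_def)
  also have "\<dots> = (LINT x|lborel. f x)"
    using assms(1) borel_measurable_continuous_onI by (intro integral_completion) simp
  finally show ?thesis .
qed

lemma test_function_outside: "test_function f \<Longrightarrow> x \<notin> Q \<Longrightarrow> f x = 0"
  using test_function_support by blast

lemma integral_mult_test_function:
  assumes "smooth_on Q u" "test_function g"
  shows "(LINT x:Q|lebesgue. u x * g x) = (LINT x|lborel. u x * g x)"
    and "integrable lborel (\<lambda>x. u x * g x)"
proof -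
  have c: "continuous_on UNIV (\<lambda>x. u x * g x)"
    using assms continuous_on_mult_test_function smooth_on_continuous by blast
  show "(LINT x:Q|lebesgue. u x * g x) = (LINT x|lborel. u x * g x)"
    by (rule set_integral_Q [OF c]) (simp add: test_function_outside [OF assms(2)])
  obtain K where "compact K" "\<And>x. x \<notin> K \<Longrightarrow> g x = 0"
    using assms(2) by (meson test_function_support)
  then show "integrable lborel (\<lambda>x. u x * g x)"
    using integrable_compact_support [OF c] by simp
qed

lemma integral_by_parts_partial:
  assumes u: "smooth_on Q u" and g: "test_function g"
  shows "(LINT x|lborel. u x * partial i g x) = - (LINT x|lborel. partial i u x * g x)"
proof -
  obtain K where K: "compact K" "K \<subseteq> Q" "\<And>x. x \<notin> K \<Longrightarrow> g x = 0"
    using test_function_support [OF g] by metis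
  have g0: "partial i g x = 0" if "x \<notin> K" for x
    using partial_zero_outside K that compact_imp_closed by metis
  let ?F = "\<lambda>x. u x * g x"
  have D: "?F differentiable (at x) \<and> partial i ?F x = u x * partial i g x + partial i u x * g x" for x
  proof (cases "x \<in> K")
    case True
    then have "u differentiable (at x)" "g differentiable (at x)"
      using u g K(2) smooth_on_differentiable test_function_smooth by blast+
    then have "(u has_derivative frechet_derivative u (at x)) (at x)"
      "(g has_derivative frechet_derivative g (at x)) (at x)"
      using frechet_derivative_works by blast+
    from has_derivative_mult [OF this] show ?thesis
      by (auto simp: partial_eq partial_def [of i u] partial_def [of i g] intro: differentiableI)
  next
    case False
    have "(?F has_derivative (\<lambda>_. 0)) (at x)"
    proof (rule has_derivative_transform_within_open [of "\<lambda>_. 0"])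
      show "open (- K)" "x \<in> - K" using False compact_imp_closed [OF K(1)] by auto
      show "0 = ?F y" if "y \<in> - K" for y using K(3) that by simp
    qed simp
    then show ?thesis
      using False by (auto simp: partial_eq K(3) g0 intro: differentiableI)
  qed
  have int: "integrable lborel (\<lambda>x. u x * partial i g x)" "integrable lborel (\<lambda>x. partial i u x * g x)"
    using u g by (auto intro!: integral_mult_test_function smooth_on_partial test_function_partial)
  have "continuous_on UNIV (\<lambda>x. u x * partial i g x + partial i u x * g x)"
    using u g
    by (intro continuous_on_add continuous_on_mult_test_function smooth_on_continuous
        smooth_on_partial test_function_partial)
  then have "continuous_on UNIV (partial i ?F)"
    using D by (simp add: fun_eq_iff cong: continuous_on_cong)
  then have "(LINT x|lborel. partial i ?F x) = 0"
    using D K by (intro integral_partial_zero [of ?F i K]) auto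
  then show ?thesis
    using D int by simp
qed

lemma integral_by_parts_partials:
  assumes "smooth_on Q u" "test_function g"
  shows "(LINT x|lborel. u x * partials is g x)
    = (-1) ^ length is * (LINT x|lborel. partials (rev is) u x * g x)"
  using assms(1)
proof (induction "is" arbitrary: u)
  case (Cons i "is")
  have "(LINT x|lborel. u x * partials (i # is) g x)
      = - (LINT x|lborel. partial i u x * partials is g x)"
    using Cons.prems assms(2) by (simp add: integral_by_parts_partial test_function_partials)
  then show ?case
    using Cons.IH [of "partial i u"] Cons.prems by (simp add: smooth_on_partial partials_append)
qed simp

lemma is_formal_adjoint_unique:
  assumes "is_formal_adjoint d B \<phi> \<psi>" "is_formal_adjoint d B \<phi> \<psi>'"
  shows "\<psi> = \<psi>'"
proof -
  define v where "v x = \<psi> x + (- 1) * \<psi>' x" for x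
  have tf: "test_function \<psi>" "test_function \<psi>'"
    using assms by (auto simp: is_formal_adjoint_def)
  have v: "test_function v"
    unfolding v_def using tf by (intro test_function_add test_function_cmult)
  then have vQ: "smooth_on Q v"
    using smooth_on_subset test_function_smooth by blast
  have "(LINT x:Q|lebesgue. v x * \<psi> x) = (LINT x:Q|lebesgue. v x * \<psi>' x)"
    using assms vQ by (simp add: is_formal_adjoint_def)
  then have "(LINT x|lborel. v x * \<psi> x) = (LINT x|lborel. v x * \<psi>' x)"
    using integral_mult_test_function(1) vQ tf by metis
  moreover have "(LINT x|lborel. v x * v x)
      = (LINT x|lborel. v x * \<psi> x) - (LINT x|lborel. v x * \<psi>' x)"
    using integral_mult_test_function(2) [OF vQ tf(1)] integral_mult_test_function(2) [OF vQ tf(2)]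
    by (subst Bochner_Integration.integral_diff [symmetric])
      (assumption, assumption, simp add: v_def right_diff_distrib)
  ultimately have "(LINT x|lborel. v x * v x) = 0" by simp
  then have "AE x in lborel. v x * v x = 0"
    using integral_nonneg_eq_0_iff_AE [of lborel "\<lambda>x. v x * v x"]
      integral_mult_test_function(2) [OF vQ v] by simp
  moreover have "open {x. v x \<noteq> 0}"
    using smooth_on_continuous [OF test_function_smooth [OF v]]
    by (intro open_Collect_neq) auto
  moreover from this have "{x. v x \<noteq> 0} \<in> sets lborel" by simp
  ultimately have "{x. v x \<noteq> 0} \<in> null_sets lborel"
    by (subst (asm) AE_iff_null) auto
  then have "negligible {x. v x \<noteq> 0}"
    by (simp add: negligible_iff_null_sets null_sets_completionI)
  then have "{x. v x \<noteq> 0} = {}"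
    using \<open>open {x. v x \<noteq> 0}\<close> open_not_negligible by blast
  then have "v x = 0" for x by blast
  then show ?thesis by (auto simp: v_def fun_eq_iff)
qed

lemma integral_double_sum:
  fixes c :: "'a \<Rightarrow> 'b \<Rightarrow> real" and f :: "'a \<Rightarrow> 'b \<Rightarrow> 'c \<Rightarrow> real"
  assumes "\<And>a b. a \<in> A \<Longrightarrow> integrable M (f a b)"
  shows "(LINT x|M. (\<Sum>a\<in>A. \<Sum>b\<in>C a. c a b * f a b x))
    = (\<Sum>a\<in>A. \<Sum>b\<in>C a. c a b * (LINT x|M. f a b x))"
proof -
  have "(LINT x|M. (\<Sum>a\<in>A. \<Sum>b\<in>C a. c a b * f a b x))
    = (\<Sum>a\<in>A. (LINT x|M. (\<Sum>b\<in>C a. c a b * f a b x)))"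
    using assms by (intro Bochner_Integration.integral_sum Bochner_Integration.integrable_sum
        integrable_mult_right)
  also have "\<dots> = (\<Sum>a\<in>A. \<Sum>b\<in>C a. (LINT x|M. c a b * f a b x))"
    using assms by (intro sum.cong refl Bochner_Integration.integral_sum integrable_mult_right)
  finally show ?thesis by simp
qed

theorem is_formal_adjoint_explicit:
  assumes "test_field d \<phi>"
  shows "is_formal_adjoint d B \<phi> (\<lambda>x. \<Sum>\<alpha>\<in>coords d. \<Sum>\<beta> | length \<beta> = length \<alpha>.
    (- 1) ^ length \<alpha> * B (length \<alpha>) \<alpha> \<beta> * partials (rev \<beta>) (\<lambda>y. \<phi> y \<alpha>) x)"
    (is "is_formal_adjoint d B \<phi> ?\<psi>")
  unfolding is_formal_adjoint_def
proof (intro conjI allI impI)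
  have tf: "test_function (\<lambda>y. \<phi> y \<alpha>)" if "\<alpha> \<in> coords d" for \<alpha>
    using assms that by (simp add: test_field_def)
  show tp: "test_function ?\<psi>"
    by (intro test_function_sum test_function_cmult test_function_partials tf)
  fix u :: "real ^ 'a \<Rightarrow> real"
  assume u: "smooth_on Q u"
  let ?c = "\<lambda>\<alpha> \<beta>. B (length \<alpha>) \<alpha> \<beta>"
  have int1: "integrable lborel (\<lambda>x. u x * partials (rev \<beta>) (\<lambda>y. \<phi> y \<alpha>) x)"
    and int2: "integrable lborel (\<lambda>x. partials \<beta> u x * \<phi> x \<alpha>)"
    and cont2: "continuous_on UNIV (\<lambda>x. partials \<beta> u x * \<phi> x \<alpha>)"
    if "\<alpha> \<in> coords d" for \<alpha> \<beta>
    using u tf [OF that]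
    by - (intro integral_mult_test_function(2) continuous_on_mult_test_function
        test_function_partials smooth_on_partials smooth_on_continuous; assumption)+
  have R: "(\<Sum>\<alpha>\<in>coords d. \<phi> x \<alpha> * apply_op B u x \<alpha>)
      = (\<Sum>\<alpha>\<in>coords d. \<Sum>\<beta> | length \<beta> = length \<alpha>. ?c \<alpha> \<beta> * (partials \<beta> u x * \<phi> x \<alpha>))" for x
    by (simp add: apply_op_def sum_distrib_left mult_ac)
  have L: "u x * ?\<psi> x = (\<Sum>\<alpha>\<in>coords d. \<Sum>\<beta> | length \<beta> = length \<alpha>.
      (- 1) ^ length \<alpha> * ?c \<alpha> \<beta> * (u x * partials (rev \<beta>) (\<lambda>y. \<phi> y \<alpha>) x))" for x
    by (simp add: sum_distrib_left mult_ac)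
  have "(LINT x:Q|lebesgue. u x * ?\<psi> x) = (LINT x|lborel. u x * ?\<psi> x)"
    using u tp by (rule integral_mult_test_function(1))
  also have "\<dots> = (\<Sum>\<alpha>\<in>coords d. \<Sum>\<beta> | length \<beta> = length \<alpha>.
      (- 1) ^ length \<alpha> * ?c \<alpha> \<beta> * (LINT x|lborel. u x * partials (rev \<beta>) (\<lambda>y. \<phi> y \<alpha>) x))"
    unfolding L using int1
    by (rule integral_double_sum)
  also have "\<dots> = (\<Sum>\<alpha>\<in>coords d. \<Sum>\<beta> | length \<beta> = length \<alpha>.
      ?c \<alpha> \<beta> * (LINT x|lborel. partials \<beta> u x * \<phi> x \<alpha>))"
  proof (intro sum.cong refl)
    fix \<alpha> \<beta> :: "'a list"
    assume a: "\<alpha> \<in> coords d" "\<beta> \<in> {\<beta>. length \<beta> = length \<alpha>}"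
    have "(- 1 :: real) ^ length \<alpha> * (- 1) ^ length \<alpha> = 1"
      by (simp flip: power_mult_distrib)
    then show "(- 1) ^ length \<alpha> * ?c \<alpha> \<beta> * (LINT x|lborel. u x * partials (rev \<beta>) (\<lambda>y. \<phi> y \<alpha>) x)
        = ?c \<alpha> \<beta> * (LINT x|lborel. partials \<beta> u x * \<phi> x \<alpha>)"
      using integral_by_parts_partials [OF u tf [OF a(1)], of "rev \<beta>"] a(2) by simp
  qed
  also have "\<dots> = (LINT x|lborel. (\<Sum>\<alpha>\<in>coords d. \<phi> x \<alpha> * apply_op B u x \<alpha>))"
    unfolding R using int2
    by (rule integral_double_sum [symmetric])
  also have "\<dots> = (LINT x:Q|lebesgue. \<Sum>\<alpha>\<in>coords d. \<phi> x \<alpha> * apply_op B u x \<alpha>)"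
  proof (rule set_integral_Q [symmetric])
    show "continuous_on UNIV (\<lambda>x. \<Sum>\<alpha>\<in>coords d. \<phi> x \<alpha> * apply_op B u x \<alpha>)"
      unfolding R using cont2 by (intro continuous_on_sum continuous_on_mult_left)
    show "(\<Sum>\<alpha>\<in>coords d. \<phi> x \<alpha> * apply_op B u x \<alpha>) = 0" if "x \<notin> Q" for x
      using test_function_outside [OF tf that] by simp
  qed
  finally show "(LINT x:Q|lebesgue. u x * ?\<psi> x)
      = (LINT x:Q|lebesgue. \<Sum>\<alpha>\<in>coords d. \<phi> x \<alpha> * apply_op B u x \<alpha>)" .
qed

theorem formal_adjoint:
  assumes "test_field d \<phi>"
  shows "is_formal_adjoint d B \<phi> (formal_adjoint d B \<phi>)"
  unfolding formal_adjoint_def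
  using is_formal_adjoint_explicit [OF assms, of B] is_formal_adjoint_unique [of d B \<phi>]
  by (intro theI' [of "is_formal_adjoint d B \<phi>"]) (rule ex1I)

theorem formal_adjoint_eq:
  assumes "test_field d \<phi>"
  shows "formal_adjoint d B \<phi> = (\<lambda>x. \<Sum>\<alpha>\<in>coords d. \<Sum>\<beta> | length \<beta> = length \<alpha>.
    (- 1) ^ length \<alpha> * B (length \<alpha>) \<alpha> \<beta> * partials (rev \<beta>) (\<lambda>y. \<phi> y \<alpha>) x)"
  using is_formal_adjoint_unique [OF formal_adjoint [OF assms] is_formal_adjoint_explicit [OF assms]] .

end

(* For a fixed test field the pairing of u with the formal adjoint is a finite linear combination
   of the entries of the operator, hence continuous in the operator; PV is a supremum of such
   functionals. *)

theory Submission
  imports Defs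
begin

text \<open>Continuity bounds \<open>g\<close> on its compact support, and elsewhere its only value
  is 0. Boundedness lets \<open>g\<close> multiply a merely integrable function.\<close>

lemma test_function_bounded:
  assumes "test_function g"
  shows "bounded (range g)"
proof -
  obtain K where K: "compact K" "\<And>x. x \<notin> K \<Longrightarrow> g x = 0"
    using assms test_function_support by metis
  have "compact (g ` K)"
    using K(1) smooth_on_continuous [OF test_function_smooth [OF assms]]
    by (meson compact_continuous_image continuous_on_subset subset_UNIV)
  then have "bounded (insert 0 (g ` K))"
    by (simp add: compact_imp_bounded)
  moreover have "range g \<subseteq> insert 0 (g ` K)"
    using K(2) by auto
  ultimately show ?thesis
    by (rule bounded_subset)
qed

lemma absolutely_integrable_mult_test_function:
  fixes u :: "real ^ 'n \<Rightarrow> real"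
  assumes "u absolutely_integrable_on Q" "test_function g"
  shows "(\<lambda>x. u x * g x) absolutely_integrable_on Q"
proof -
  have Q: "(Q :: (real ^ 'n) set) \<in> sets lebesgue"
    by (intro sets_completionI_sets) (simp add: open_Q)
  have "g \<in> borel_measurable (lebesgue_on Q)"
    using smooth_on_continuous [OF test_function_smooth [OF assms(2)]] Q
    by (intro continuous_imp_measurable_on_sets_lebesgue) (auto intro: continuous_on_subset)
  \<comment> \<open>The bounded measurable factor comes first, as the product rule for absolutely
    integrable functions expects.\<close>
  then have "(\<lambda>x. g x * u x) absolutely_integrable_on Q"
    using assms(1) Q bounded_subset [OF test_function_bounded [OF assms(2)] image_mono [OF subset_UNIV]]
    by (intro absolutely_integrable_bounded_measurable_product [OF bilinear_times])
  then show ?thesis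
    by (simp add: mult.commute)
qed

text \<open>As \<open>u\<close> is only integrable, the duality identity for smooth functions does
  not apply to it; the explicit formula for the adjoint is integrated term by term instead. The
  remaining integrals do not involve \<open>B\<close>, so the pairing is linear in the entries of
  \<open>B\<close>.\<close>

lemma integral_mult_formal_adjoint:
  fixes u :: "real ^ 'n \<Rightarrow> real"
  assumes "u absolutely_integrable_on Q" "test_field d \<phi>"
  shows "(LINT x:Q|lebesgue. u x * formal_adjoint d B \<phi> x) =
    (\<Sum>\<alpha>\<in>coords d. \<Sum>\<beta> | length \<beta> = length \<alpha>. (- 1) ^ length \<alpha> * B (length \<alpha>) \<alpha> \<beta> *
      (LINT x:Q|lebesgue. u x * partials (rev \<beta>) (\<lambda>y. \<phi> y \<alpha>) x))"
proof -
  \<comment> \<open>The indicator is absorbed into each term, which turns set integrals into plain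
    ones, the form that \<open>integral_double_sum\<close> handles.\<close>
  let ?f = "\<lambda>\<alpha> \<beta> x. indicator Q x *\<^sub>R (u x * partials (rev \<beta>) (\<lambda>y. \<phi> y \<alpha>) x)"
  have int: "integrable lebesgue (?f \<alpha> \<beta>)" if "\<alpha> \<in> coords d" for \<alpha> \<beta>
    using absolutely_integrable_mult_test_function [OF assms(1) test_function_partials] that assms(2)
    by (auto simp: set_integrable_def test_field_def)
  have "indicator Q x *\<^sub>R (u x * formal_adjoint d B \<phi> x) =
      (\<Sum>\<alpha>\<in>coords d. \<Sum>\<beta> | length \<beta> = length \<alpha>.
        (- 1) ^ length \<alpha> * B (length \<alpha>) \<alpha> \<beta> * ?f \<alpha> \<beta> x)" for x
    by (simp add: formal_adjoint_eq [OF assms(2)] sum_distrib_left mult_ac)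
  then show ?thesis
    unfolding set_lebesgue_integral_def by (simp only: integral_double_sum [OF int])
qed

text \<open>Makes the \<open>Max\<close> in \<open>linf_norm\<close> a genuine maximum: over a
  finite alphabet there are finitely many index pairs of length \<open>h\<close>.\<close>

lemma finite_matrix_entries:
  fixes A :: "'n::finite list \<Rightarrow> 'n list \<Rightarrow> real"
  shows "finite {\<bar>A \<alpha> \<beta>\<bar> |\<alpha> \<beta>. length \<alpha> = h \<and> length \<beta> = h}"
proof -
  have "{\<bar>A \<alpha> \<beta>\<bar> |\<alpha> \<beta>. length \<alpha> = h \<and> length \<beta> = h}
    = (\<lambda>(\<alpha>, \<beta>). \<bar>A \<alpha> \<beta>\<bar>) ` ({\<alpha>. length \<alpha> = h} \<times> {\<beta>. length \<beta> = h})"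
    by auto
  then show ?thesis by simp
qed

lemma entry_le_linf_norm:
  fixes A :: "'n::finite list \<Rightarrow> 'n list \<Rightarrow> real"
  assumes "length \<alpha> = h" "length \<beta> = h"
  shows "\<bar>A \<alpha> \<beta>\<bar> \<le> linf_norm h A"
  unfolding linf_norm_def using assms by (intro Max_ge finite_matrix_entries) blast

lemma linf_norm_nonneg: "0 \<le> linf_norm h (A :: 'n::finite list \<Rightarrow> 'n list \<Rightarrow> real)"
  \<comment> \<open>A constant list supplies an index of length \<open>h\<close>, for
    \<open>h = 0\<close> too, so the norm dominates the absolute value of some entry.\<close>
  using entry_le_linf_norm [of "replicate h undefined" h "replicate h undefined" A]
  by (meson abs_ge_zero length_replicate order_trans)

text \<open>The norm at order \<open>h\<close> bounds the entry, and it is one summand of a sum of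
  nonnegative terms.\<close>

lemma entry_diff_le_op_dist:
  fixes A B :: "'n::finite op"
  assumes "1 \<le> h" "h \<le> d" "length \<alpha> = h" "length \<beta> = h"
  shows "\<bar>A h \<alpha> \<beta> - B h \<alpha> \<beta>\<bar> \<le> op_dist d A B"
proof -
  have "\<bar>A h \<alpha> \<beta> - B h \<alpha> \<beta>\<bar> \<le> linf_norm h (\<lambda>\<alpha> \<beta>. A h \<alpha> \<beta> - B h \<alpha> \<beta>)"
    using entry_le_linf_norm [OF assms(3,4), of "\<lambda>\<alpha> \<beta>. A h \<alpha> \<beta> - B h \<alpha> \<beta>"] .
  also have "\<dots> \<le> op_dist d A B"
    unfolding op_dist_def using assms by (intro member_le_sum) (auto intro: linf_norm_nonneg)
  finally show ?thesis .
qed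

lemma tendsto_entry:
  fixes A :: "nat \<Rightarrow> 'n::finite op"
  assumes "(\<lambda>n. op_dist d (A n) B) \<longlonglongrightarrow> 0" "1 \<le> h" "h \<le> d" "length \<alpha> = h" "length \<beta> = h"
  shows "(\<lambda>n. A n h \<alpha> \<beta>) \<longlonglongrightarrow> B h \<alpha> \<beta>"
proof -
  have "(\<lambda>n. A n h \<alpha> \<beta> - B h \<alpha> \<beta>) \<longlonglongrightarrow> 0"
    using assms by (intro Lim_null_comparison [OF _ assms(1)] always_eventually)
      (auto intro: entry_diff_le_op_dist)
  then show ?thesis
    by (rule LIM_zero_cancel)
qed

theorem proposition2p8:
  fixes d :: nat
    and u :: "real ^ 'n \<Rightarrow> real"
    and \<B> :: "'n op"
    and \<B>\<^sub>n :: "nat \<Rightarrow> 'n op"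
  assumes "d \<ge> 1"
    and "u absolutely_integrable_on Q"
    and "\<And>n. \<B>\<^sub>n n \<in> Pi_ops d"
    and "\<B> \<in> Pi_ops d"
    and "(\<lambda>n. op_dist d (\<B>\<^sub>n n) \<B>) \<longlonglongrightarrow> 0"
  shows "liminf (\<lambda>n. PV d (\<B>\<^sub>n n) u) \<ge> PV d \<B> u"
  unfolding PV_def [of d \<B> u]
proof (rule SUP_least)
  fix \<phi> :: "real ^ 'n \<Rightarrow> 'n list \<Rightarrow> real"
  assume \<phi>: "\<phi> \<in> {\<phi>. test_field d \<phi> \<and> (\<forall>x. L2_set (\<phi> x) (coords d) \<le> 1)}"
  let ?L = "\<lambda>B. LINT x:Q|lebesgue. u x * formal_adjoint d B \<phi> x"
  have "(\<lambda>n. ?L (\<B>\<^sub>n n)) \<longlonglongrightarrow> ?L \<B>"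
    \<comment> \<open>Both pairings become finite sums with the same integrals as coefficients.
      Unfolding \<open>coords_def\<close> yields the bounds on the length of \<alpha> under which
      entries converge.\<close>
    using \<phi> by (auto simp: integral_mult_formal_adjoint [OF assms(2)] coords_def
        intro!: tendsto_intros tendsto_entry [OF assms(5)])
  then have "ereal (?L \<B>) = liminf (\<lambda>n. ereal (?L (\<B>\<^sub>n n)))"
    by (intro lim_imp_Liminf [symmetric] tendsto_ereal) auto
  \<comment> \<open>The constraints on \<phi> do not mention the operator, so the same \<phi>
    competes in the supremum for every \<open>n\<close>.\<close>
  also have "\<dots> \<le> liminf (\<lambda>n. PV d (\<B>\<^sub>n n) u)"
    unfolding PV_def using \<phi> by (intro Liminf_mono always_eventually allI SUP_upper)
  finally show "ereal (?L \<B>) \<le> liminf (\<lambda>n. PV d (\<B>\<^sub>n n) u)" .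
qed

end
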